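(* Let $S\subset\partial\mathbb{D}$ be a nonempty closed subset, let $\phi:\partial\mathbb{D}\to\partial\mathbb{D}$ be a $C^1$ diffeomorphism, and set $\widetilde S:=\phi(S)$. Then the pullback $\phi^*$, $\phi^*(f):=f\circ\phi$, maps $AP(\widetilde S)$ isomorphically onto $AP(S)$.
   Context: $\mathbb{D}\subset\mathbb{C}$ is the open unit disk; $\partial\mathbb{D}$ carries the counterclockwise orientation. A continuous function $f:\mathbb{R}\to\mathbb{C}$ is almost periodic if for any $\epsilon>0$ there is $l(\epsilon)>0$ such that for every $t_0\in\mathbb{R}$ the interval $[t_0,t_0+l(\epsilon)]$ contains a number $\tau$ with $|f(t)-f(t+\tau)|<\epsilon$ for all $t\in\mathbb{R}$. For $t_0\in\mathbb{R}$, $k\in\{-1,1\}$, $0<s\le 2\pi$ set $\gamma_{t_0^k}(s):=\{e^{i(t_0+kt)}: 0<t<s\}$. A continuous function $f_k:\gamma_{t_0^k}(s)\to\mathbb{C}$ is almost periodic if the function $\widehat f_k:(-\infty,0)\to\mathbb{C}$, $\widehat f_k(t):=f_k(e^{i(t_0+kse^t)})$, is the restriction of an almost periodic function on $\mathbb{R}$. $AP(\partial\mathbb{D})\subset L^\infty(\partial\mathbb{D})$ is the uniform subalgebra of functions $f$ such that for each $t_0\in\mathbb{R}$ and $\epsilon>0$ there are $s=s(t_0,\epsilon)\in(0,\pi)$ and almost periodic functions $f_k:\gamma_{t_0^k}(s)\to\mathbb{C}$, $k\in\{-1,1\}$, with $\operatorname{ess\,sup}_{\gamma_{t_0^k}(s)}|f-f_k|<\epsilon$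 for both $k$. For a nonempty closed $S\subset\partial\mathbb{D}$, $AP(S)\subset AP(\partial\mathbb{D})$ is the uniform algebra of functions from $AP(\partial\mathbb{D})$ that are continuous on $\partial\mathbb{D}\setminus S$. *)

theory Defs
  imports "HOL-Probability.Essential_Supremum"
begin

section \<open>Arc length on the unit circle\<close>

abbreviation unit_circle :: "complex set" where
  "unit_circle \<equiv> sphere 0 1"

text \<open>Functions on the circle are rendered as total functions \<^typ>\<open>complex \<Rightarrow> complex\<close>. The space of the
  following measure is the circle itself, so that the values off the circle matter neither for
  measurability nor for almost everywhere statements.\<close>

definition circle_measure :: "complex measure" where
  "circle_measure = distr (restrict_space lborel {0..<2*pi}) (restrict_space borel unit_circle) cis"

lemma cis_measurable_circle [measurable]:
  "cis \<in> restrict_space lborel {0..<2*pi} \<rightarrow>\<^sub>M restrict_space borel unit_circle"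
proof (rule measurable_restrict_space2)
  have "cis \<in> borel_measurable borel"
    by (intro borel_measurable_continuous_onI continuous_intros)
  then have "cis \<in> borel_measurable lborel"
    by simp
  then show "cis \<in> restrict_space lborel {0..<2*pi} \<rightarrow>\<^sub>M borel"
    by (rule measurable_restrict_space1)
qed auto

lemma space_circle_measure [simp]: "space circle_measure = unit_circle"
  by (simp add: circle_measure_def space_restrict_space)

lemma sets_circle_measure [measurable_cong]:
  "sets circle_measure = sets (restrict_space borel unit_circle)"
  by (simp add: circle_measure_def)

lemma emeasure_circle_measure_space: "emeasure circle_measure unit_circle = ennreal (2*pi)"
proof -
  have "emeasure circle_measure unit_circle
      = emeasure (restrict_space lborel {0..<2*pi}) (cis -` unit_circle \<inter> {0..<2*pi})"
    unfolding circle_measure_def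
    by (subst emeasure_distr) (auto simp: sets_restrict_space space_restrict_space intro!: image_eqI[of _ _ UNIV])
  also have "cis -` unit_circle \<inter> {0..<2*pi} = {0..<2*pi}"
    by auto
  also have "emeasure (restrict_space lborel {0..<2*pi}) {0..<2*pi} = ennreal (2*pi)"
    by (subst emeasure_restrict_space) auto
  finally show ?thesis .
qed

lemma AE_circle_measure_False: "\<not> (AE z in circle_measure. False)"
proof
  assume "AE z in circle_measure. False"
  then have "emeasure circle_measure (space circle_measure) = 0"
    by (subst (asm) AE_iff_measurable[OF sets.top]) auto
  then show False
    using emeasure_circle_measure_space pi_gt_zero by (simp add: ennreal_eq_0_iff del: pi_gt_zero)
qed


section \<open>The algebra of essentially bounded functions modulo null sets\<close>

text \<open>Borel representatives suffice: every Lebesgue measurable function agrees almost everywhere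
  with a Borel measurable one.\<close>

definition ess_norm :: "(complex \<Rightarrow> complex) \<Rightarrow> ereal" where
  "ess_norm f = esssup circle_measure (\<lambda>z. ereal (cmod (f z)))"

definition linf_function :: "(complex \<Rightarrow> complex) \<Rightarrow> bool" where
  "linf_function f \<longleftrightarrow> f \<in> borel_measurable circle_measure \<and> ess_norm f < \<infinity>"

lemma linf_function_measurable [measurable_dest]:
  "linf_function f \<Longrightarrow> f \<in> borel_measurable circle_measure"
  by (simp add: linf_function_def)

lemma ess_norm_le_iff:
  assumes [measurable]: "f \<in> borel_measurable circle_measure"
  shows "ess_norm f \<le> ereal c \<longleftrightarrow> (AE z in circle_measure. cmod (f z) \<le> c)"
proof
  assume le: "ess_norm f \<le> ereal c"
  have "AE z in circle_measure. ereal (cmod (f z)) \<le> ess_norm f"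
    unfolding ess_norm_def by (rule esssup_AE)
  then show "AE z in circle_measure. cmod (f z) \<le> c"
  proof eventually_elim
    case (elim z)
    then have "ereal (cmod (f z)) \<le> ereal c" using le by (rule order_trans)
    then show ?case by simp
  qed
next
  assume "AE z in circle_measure. cmod (f z) \<le> c"
  then show "ess_norm f \<le> ereal c"
    unfolding ess_norm_def by (intro esssup_I) auto
qed

lemma linf_functionI:
  assumes "f \<in> borel_measurable circle_measure" "AE z in circle_measure. cmod (f z) \<le> c"
  shows "linf_function f"
  using assms ess_norm_le_iff[of f c] by (auto simp: linf_function_def)

lemma ess_norm_nonneg:
  assumes [measurable]: "f \<in> borel_measurable circle_measure"
  shows "0 \<le> ess_norm f"
proof -
  have AE: "AE z in circle_measure. ereal (cmod (f z)) \<le> ess_norm f"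
    unfolding ess_norm_def by (rule esssup_AE)
  have False if "ess_norm f < 0"
  proof -
    have "AE z in circle_measure. False"
      using AE
    proof eventually_elim
      case (elim z)
      then have "ereal (cmod (f z)) < 0" using that by (rule order.strict_trans1)
      then show ?case by simp
    qed
    then show False using AE_circle_measure_False by simp
  qed
  then show ?thesis by force
qed

lemma ess_norm_real:
  assumes "linf_function f"
  shows "ess_norm f = ereal (real_of_ereal (ess_norm f))"
  using assms ess_norm_nonneg[of f] unfolding linf_function_def
  by (cases "ess_norm f") auto

lemma real_ess_norm_le_iff:
  assumes "linf_function f"
  shows "real_of_ereal (ess_norm f) \<le> c \<longleftrightarrow> (AE z in circle_measure. cmod (f z) \<le> c)"
  using ess_norm_le_iff[of f c] ess_norm_real[OF assms] assms
  by (metis ereal_less_eq(3) linf_function_def)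

lemma AE_le_ess_norm:
  assumes "linf_function f"
  shows "AE z in circle_measure. cmod (f z) \<le> real_of_ereal (ess_norm f)"
  using real_ess_norm_le_iff[OF assms] by blast

lemma linf_function_const: "linf_function (\<lambda>_. c)"
  by (rule linf_functionI[where c = "cmod c"]) auto

lemma linf_function_add:
  assumes f: "linf_function f" and g: "linf_function g"
  shows "linf_function (\<lambda>z. f z + g z)"
proof (rule linf_functionI)
  show "(\<lambda>z. f z + g z) \<in> borel_measurable circle_measure"
    using f g by measurable
  show "AE z in circle_measure. cmod (f z + g z)
      \<le> real_of_ereal (ess_norm f) + real_of_ereal (ess_norm g)"
    using AE_le_ess_norm[OF f] AE_le_ess_norm[OF g]
    by eventually_elim (rule order_trans[OF norm_triangle_ineq add_mono])
qed

lemma linf_function_mult: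
  assumes f: "linf_function f" and g: "linf_function g"
  shows "linf_function (\<lambda>z. f z * g z)"
proof (rule linf_functionI)
  show "(\<lambda>z. f z * g z) \<in> borel_measurable circle_measure"
    using f g by measurable
  show "AE z in circle_measure. cmod (f z * g z)
      \<le> real_of_ereal (ess_norm f) * real_of_ereal (ess_norm g)"
    using AE_le_ess_norm[OF f] AE_le_ess_norm[OF g]
    by eventually_elim
      (simp add: norm_mult mult_mono order_trans[OF norm_ge_zero])
qed

lemma linf_function_uminus: "linf_function f \<Longrightarrow> linf_function (\<lambda>z. - f z)"
  using linf_function_mult[OF linf_function_const[of "-1"]] by simp

lemma linf_function_diff:
  "linf_function f \<Longrightarrow> linf_function g \<Longrightarrow> linf_function (\<lambda>z. f z - g z)"
  using linf_function_add[OF _ linf_function_uminus] by simp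

lemma ess_norm_AE_cong:
  assumes "linf_function f" "linf_function g" "AE z in circle_measure. f z = g z"
  shows "ess_norm f = ess_norm g"
proof -
  have "f \<in> borel_measurable circle_measure" "g \<in> borel_measurable circle_measure"
    using assms by (simp_all add: linf_function_def)
  then show ?thesis
    unfolding ess_norm_def
    by (intro esssup_AE_cong) (use assms(3) in \<open>auto elim: eventually_mono\<close>)
qed

definition linf_eq :: "(complex \<Rightarrow> complex) \<Rightarrow> (complex \<Rightarrow> complex) \<Rightarrow> bool" where
  "linf_eq f g \<longleftrightarrow> linf_function f \<and> linf_function g \<and> (AE z in circle_measure. f z = g z)"

lemma part_equivp_linf_eq: "part_equivp linf_eq"
proof (rule part_equivpI)
  show "\<exists>f. linf_eq f f"
    using linf_function_const[of 0] by (auto simp: linf_eq_def)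
  show "symp linf_eq"
    by (auto intro!: sympI simp: linf_eq_def elim: eventually_mono)
  show "transp linf_eq"
    by (auto intro!: transpI simp: linf_eq_def)
qed

quotient_type linf = "complex \<Rightarrow> complex" / partial: linf_eq
  morphisms linf_rep linf_class
  by (rule part_equivp_linf_eq)

instantiation linf :: comm_ring_1
begin

lift_definition zero_linf :: linf is "\<lambda>_. 0"
  by (simp add: linf_eq_def linf_function_const)

lift_definition one_linf :: linf is "\<lambda>_. 1"
  by (simp add: linf_eq_def linf_function_const)

lift_definition plus_linf :: "linf \<Rightarrow> linf \<Rightarrow> linf" is "\<lambda>f g z. f z + g z"
  unfolding linf_eq_def by (auto intro: linf_function_add)

lift_definition minus_linf :: "linf \<Rightarrow> linf \<Rightarrow> linf" is "\<lambda>f g z. f z - g z"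
  unfolding linf_eq_def by (auto intro: linf_function_diff)

lift_definition uminus_linf :: "linf \<Rightarrow> linf" is "\<lambda>f z. - f z"
  unfolding linf_eq_def by (auto intro: linf_function_uminus)

lift_definition times_linf :: "linf \<Rightarrow> linf \<Rightarrow> linf" is "\<lambda>f g z. f z * g z"
  unfolding linf_eq_def by (auto intro: linf_function_mult)

instance
proof
  show "(0::linf) \<noteq> 1"
    by transfer (simp add: linf_eq_def AE_circle_measure_False)
qed (transfer; simp add: linf_eq_def linf_function_const linf_function_add linf_function_mult
       linf_function_uminus linf_function_diff algebra_simps)+

end

lift_definition cscale :: "complex \<Rightarrow> linf \<Rightarrow> linf" is "\<lambda>c f z. c * f z"
  unfolding linf_eq_def by (auto intro: linf_function_mult linf_function_const)

instantiation linf :: real_algebra_1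
begin

definition scaleR_linf :: "real \<Rightarrow> linf \<Rightarrow> linf" where
  "scaleR_linf r = cscale (complex_of_real r)"

instance
proof
  fix r s :: real and F G :: linf
  show "r *\<^sub>R (F + G) = r *\<^sub>R F + r *\<^sub>R G"
    unfolding scaleR_linf_def
    by transfer (simp add: linf_eq_def linf_function_const linf_function_add linf_function_mult
        algebra_simps)
  show "(r + s) *\<^sub>R F = r *\<^sub>R F + s *\<^sub>R F"
    unfolding scaleR_linf_def
    by transfer (simp add: linf_eq_def linf_function_const linf_function_add linf_function_mult
        algebra_simps)
  show "r *\<^sub>R s *\<^sub>R F = (r * s) *\<^sub>R F"
    unfolding scaleR_linf_def
    by transfer (simp add: linf_eq_def linf_function_const linf_function_mult mult.assoc)
  show "1 *\<^sub>R F = F"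
    unfolding scaleR_linf_def by transfer (simp add: linf_eq_def)
  show "r *\<^sub>R F * G = r *\<^sub>R (F * G)"
    unfolding scaleR_linf_def
    by transfer (simp add: linf_eq_def linf_function_const linf_function_mult mult.assoc)
  show "F * r *\<^sub>R G = r *\<^sub>R (F * G)"
    unfolding scaleR_linf_def
    by transfer (simp add: linf_eq_def linf_function_const linf_function_mult mult.left_commute)
qed

end

instantiation linf :: real_normed_algebra_1
begin

lift_definition norm_linf :: "linf \<Rightarrow> real" is "\<lambda>f. real_of_ereal (ess_norm f)"
  unfolding linf_eq_def by (metis ess_norm_AE_cong)

definition sgn_linf :: "linf \<Rightarrow> linf" where
  "sgn_linf F = F /\<^sub>R norm F"

definition dist_linf :: "linf \<Rightarrow> linf \<Rightarrow> real" where
  "dist_linf F G = norm (F - G)"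

definition uniformity_linf :: "(linf \<times> linf) filter" where
  "uniformity_linf = (INF e\<in>{0<..}. principal {(F, G). dist F G < e})"

definition open_linf :: "linf set \<Rightarrow> bool" where
  "open_linf U = (\<forall>F\<in>U. \<forall>\<^sub>F (F', G) in uniformity. F' = F \<longrightarrow> G \<in> U)"

instance
proof
  fix r :: real and F G :: linf
  show "dist F G = norm (F - G)" by (rule dist_linf_def)
  show "sgn F = F /\<^sub>R norm F" by (rule sgn_linf_def)
  show "(uniformity :: (linf \<times> linf) filter) = (INF e\<in>{0<..}. principal {(F, G). dist F G < e})"
    by (rule uniformity_linf_def)
  show "open U \<longleftrightarrow> (\<forall>F\<in>U. \<forall>\<^sub>F (F', G) in uniformity. F' = F \<longrightarrow> G \<in> U)" for U :: "linf set"
    by (rule open_linf_def)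
  show "norm (F + G) \<le> norm F + norm G"
  proof (transfer, goal_cases)
    case (1 f g)
    then have f: "linf_function f" and g: "linf_function g" by (auto simp: linf_eq_def)
    show ?case
      unfolding real_ess_norm_le_iff[OF linf_function_add[OF f g]]
      using AE_le_ess_norm[OF f] AE_le_ess_norm[OF g]
      by eventually_elim (rule order_trans[OF norm_triangle_ineq add_mono])
  qed
  show "norm (F * G) \<le> norm F * norm G"
  proof (transfer, goal_cases)
    case (1 f g)
    then have f: "linf_function f" and g: "linf_function g" by (auto simp: linf_eq_def)
    show ?case
      unfolding real_ess_norm_le_iff[OF linf_function_mult[OF f g]]
      using AE_le_ess_norm[OF f] AE_le_ess_norm[OF g]
      by eventually_elim (simp add: norm_mult mult_mono order_trans[OF norm_ge_zero])
  qed
  show "norm (r *\<^sub>R F) = \<bar>r\<bar> * norm F"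
    unfolding scaleR_linf_def
  proof (transfer, goal_cases)
    case (1 r f)
    then have f: "linf_function f" by (simp add: linf_eq_def)
    have rf: "linf_function (\<lambda>z. complex_of_real r * f z)"
      using f by (intro linf_function_mult linf_function_const)
    show ?case
    proof (cases "r = 0")
      case True
      have "real_of_ereal (ess_norm (\<lambda>_. 0)) \<le> 0"
        unfolding real_ess_norm_le_iff[OF linf_function_const] by simp
      moreover have "0 \<le> real_of_ereal (ess_norm (\<lambda>_. 0))"
        by (simp add: ess_norm_nonneg real_of_ereal_pos)
      ultimately have "real_of_ereal (ess_norm (\<lambda>_. 0)) = 0"
        by (rule antisym)
      then show ?thesis using True by simp
    next
      case False
      show ?thesis
      proof (rule antisym)
        show "real_of_ereal (ess_norm (\<lambda>z. complex_of_real r * f z))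
            \<le> \<bar>r\<bar> * real_of_ereal (ess_norm f)"
          unfolding real_ess_norm_le_iff[OF rf]
          using AE_le_ess_norm[OF f] by eventually_elim (simp add: norm_mult mult_left_mono)
        have "real_of_ereal (ess_norm f)
            \<le> real_of_ereal (ess_norm (\<lambda>z. complex_of_real r * f z)) / \<bar>r\<bar>"
          unfolding real_ess_norm_le_iff[OF f]
          using AE_le_ess_norm[OF rf]
          by eventually_elim (use False in \<open>simp add: norm_mult field_simps\<close>)
        then show "\<bar>r\<bar> * real_of_ereal (ess_norm f)
            \<le> real_of_ereal (ess_norm (\<lambda>z. complex_of_real r * f z))"
          using False by (simp add: field_simps)
      qed
    qed
  qed
  show "norm F = 0 \<longleftrightarrow> F = 0"
  proof (transfer, goal_cases)
    case (1 f)
    then have f: "linf_function f" by (simp add: linf_eq_def)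
    have "0 \<le> real_of_ereal (ess_norm f)"
      using f by (simp add: ess_norm_nonneg real_of_ereal_pos linf_function_def)
    then have "real_of_ereal (ess_norm f) = 0 \<longleftrightarrow> real_of_ereal (ess_norm f) \<le> 0"
      by linarith
    also have "\<dots> \<longleftrightarrow> linf_eq f (\<lambda>_. 0)"
      unfolding real_ess_norm_le_iff[OF f] by (simp add: linf_eq_def f linf_function_const)
    finally show ?case .
  qed
  show "norm (1::linf) = 1"
  proof (transfer, goal_cases)
    case 1
    have "ess_norm (\<lambda>_. 1) = 1"
      unfolding ess_norm_def
      by (subst esssup_const) (simp_all add: emeasure_circle_measure_space one_ereal_def)
    then show ?case by simp
  qed
qed

end

text \<open>The pullback is computed on the representative chosen by \<^const>\<open>linf_rep\<close>. It is independent of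
  that choice only for maps under which preimages of null sets are null sets.\<close>

definition linf_pullback :: "(complex \<Rightarrow> complex) \<Rightarrow> linf \<Rightarrow> linf" where
  "linf_pullback \<phi> F = linf_class (linf_rep F \<circ> \<phi>)"

definition uniform_algebra_iso :: "linf set \<Rightarrow> linf set \<Rightarrow> (linf \<Rightarrow> linf) \<Rightarrow> bool" where
  "uniform_algebra_iso A B T \<longleftrightarrow>
     bij_betw T A B \<and>
     T 1 = 1 \<and>
     (\<forall>F\<in>A. \<forall>G\<in>A. T (F + G) = T F + T G) \<and>
     (\<forall>F\<in>A. \<forall>G\<in>A. T (F * G) = T F * T G) \<and>
     (\<forall>c. \<forall>F\<in>A. T (cscale c F) = cscale c (T F)) \<and>
     (\<forall>F\<in>A. norm (T F) = norm F)"


section \<open>Almost periodic functions on the line and on arcs\<close>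

definition almost_periodic :: "(real \<Rightarrow> complex) \<Rightarrow> bool" where
  "almost_periodic f \<longleftrightarrow>
     continuous_on UNIV f \<and>
     (\<forall>\<epsilon>>0. \<exists>l>0. \<forall>t0. \<exists>\<tau>\<in>{t0..t0 + l}. \<forall>t. cmod (f t - f (t + \<tau>)) < \<epsilon>)"

definition circle_arc :: "real \<Rightarrow> real \<Rightarrow> real \<Rightarrow> complex set" where
  "circle_arc t0 k s = {cis (t0 + k * t) | t. 0 < t \<and> t < s}"

definition almost_periodic_on_arc :: "real \<Rightarrow> real \<Rightarrow> real \<Rightarrow> (complex \<Rightarrow> complex) \<Rightarrow> bool" where
  "almost_periodic_on_arc t0 k s g \<longleftrightarrow>
     continuous_on (circle_arc t0 k s) g \<and>
     (\<exists>h. almost_periodic h \<and> (\<forall>t<0. g (cis (t0 + k * s * exp t)) = h t))"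


section \<open>The algebras AP\<close>

definition AP_circle :: "linf set" where
  "AP_circle = {F. \<forall>t0. \<forall>\<epsilon>>0. \<exists>s. 0 < s \<and> s < pi \<and>
     (\<forall>k\<in>{-1, 1}. \<exists>g. almost_periodic_on_arc t0 k s g \<and>
        esssup (restrict_space circle_measure (circle_arc t0 k s))
          (\<lambda>z. ereal (cmod (linf_rep F z - g z))) < ereal \<epsilon>)}"

text \<open>A class is continuous on a set if it has a representative that is.\<close>

definition AP :: "complex set \<Rightarrow> linf set" where
  "AP S = {F \<in> AP_circle.
     \<exists>f. linf_function f \<and> linf_class f = F \<and> continuous_on (unit_circle - S) f}"


section \<open>Diffeomorphisms of the circle\<close>

text \<open>Differentiability on the circle is expressed in the angular coordinate: \<^const>\<open>cis\<close> is a
  local diffeomorphism from the line onto the circle.\<close>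

definition C1_circle_map :: "(complex \<Rightarrow> complex) \<Rightarrow> bool" where
  "C1_circle_map \<phi> \<longleftrightarrow>
     \<phi> ` unit_circle \<subseteq> unit_circle \<and> (\<lambda>t. \<phi> (cis t)) C1_differentiable_on UNIV"

definition C1_circle_diffeo :: "(complex \<Rightarrow> complex) \<Rightarrow> bool" where
  "C1_circle_diffeo \<phi> \<longleftrightarrow>
     bij_betw \<phi> unit_circle unit_circle \<and>
     C1_circle_map \<phi> \<and> C1_circle_map (the_inv_into unit_circle \<phi>)"

end

theory Submission
  imports Defs "HOL-Library.Real_Mod"
begin

text \<open>In the coordinate \<open>u = ln r\<close> at \<open>t\<^sub>0\<close>, where \<open>r\<close> is the angular distance from \<open>t\<^sub>0\<close>, a lift \<open>\<theta>\<close> of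
  the diffeomorphism to the line acts by \<open>u \<mapsto> u + ln \<bar>\<theta>' t\<^sub>0\<bar> + o(1)\<close> as \<open>u \<rightarrow> -\<infinity>\<close>. Almost periodic functions
  are uniformly continuous and invariant under translation, so on a short arc the pullback of an
  almost periodic function is uniformly close to a translate of it. Null sets are preserved because
  differentiable maps of the line preserve them.\<close>

section \<open>Angular lifts of circle maps\<close>

lemma cis_Arg_unit: "cmod z = 1 \<Longrightarrow> cis (Arg z) = z"
  by (metis cis_Arg norm_zero sgn_eq zero_neq_one div_by_1 of_real_1)

text \<open>The lift is an antiderivative of the angular velocity \<open>w\<close> plus an initial
  phase, so its differentiability comes with the construction and no covering space argument is
  needed.\<close>

lemma C1_circle_map_lift:
  assumes "C1_circle_map \<phi>"
  obtains \<theta> :: "real \<Rightarrow> real"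
  where "\<And>t. \<theta> differentiable at t" "\<And>t. \<phi> (cis t) = cis (\<theta> t)"
proof -
  define p where "p t = \<phi> (cis t)" for t
  obtain D where D: "\<And>t. (p has_vector_derivative D t) (at t)" and cont: "continuous_on UNIV D"
    using assms by (auto simp: C1_circle_map_def C1_differentiable_on_def p_def[abs_def])
  have p1: "cmod (p t) = 1" for t
  proof -
    have "cis t \<in> unit_circle" by simp
    then have "\<phi> (cis t) \<in> unit_circle" using assms unfolding C1_circle_map_def by blast
    then show ?thesis by (simp add: p_def)
  qed
  have p0: "p t \<noteq> 0" for t using p1[of t] by auto
  have p_cont: "continuous_on UNIV p"
    using D by (meson continuous_at_imp_continuous_on has_vector_derivative_continuous)
  define w where "w t = Im (D t * cnj (p t))" for t
  have "continuous_on UNIV w"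
    unfolding w_def by (intro continuous_intros cont p_cont)
  then have "isCont w t" for t
    by (simp add: continuous_on_eq_continuous_at)
  then obtain F where F: "\<And>t. (F has_vector_derivative w t) (at t)"
    using einterval_antiderivative[of "-\<infinity>" "\<infinity>" w] by auto
  \<comment> \<open>Differentiating \<open>p t \<bullet> p t = 1\<close> shows that the velocity
    \<open>D t\<close> is tangent to the circle, hence an imaginary multiple
    \<open>\<i> * w t\<close> of \<open>p t\<close>.\<close>
  have "(p has_derivative (\<lambda>h. h *\<^sub>R D t)) (at t)" for t
    using D[of t] by (simp add: has_vector_derivative_def)
  then have "((\<lambda>t. p t \<bullet> p t) has_derivative (\<lambda>h. p t \<bullet> (h *\<^sub>R D t) + (h *\<^sub>R D t) \<bullet> p t)) (at t)" for t
    by (intro has_derivative_inner)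
  moreover have "(\<lambda>t. p t \<bullet> p t) = (\<lambda>_. 1)"
    using p1 by (simp add: dot_square_norm)
  ultimately have "((\<lambda>t::real. 1::real) has_derivative (\<lambda>h. p t \<bullet> (h *\<^sub>R D t) + (h *\<^sub>R D t) \<bullet> p t)) (at t)" for t
    by simp
  then have "(\<lambda>h::real. p t \<bullet> (h *\<^sub>R D t) + (h *\<^sub>R D t) \<bullet> p t) = (\<lambda>h. 0)" for t
    by (rule has_derivative_unique) (rule has_derivative_const)
  from fun_cong[OF this, of _ 1] have "p t \<bullet> D t = 0" for t
    by (simp add: inner_commute)
  then have "Re (D t * cnj (p t)) = 0" for t
    by (simp add: inner_complex_def mult.commute)
  then have "D t * cnj (p t) = \<i> * w t" for t
    by (simp add: complex_eq_iff w_def)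
  then have "D t * (cnj (p t) * p t) = \<i> * w t * p t" for t
    by (metis mult.assoc)
  moreover have "cnj (p t) * p t = 1" for t
    using complex_norm_square[of "p t"] p1[of t] by (simp add: mult.commute)
  ultimately have Dw: "D t = \<i> * w t * p t" for t
    by simp
  \<comment> \<open>\<open>cis (F t)\<close> solves the same linear equation as \<open>p\<close>, so
    this quotient of the two is constant. The constant has modulus 1, and its argument becomes the
    initial phase.\<close>
  have "((\<lambda>t. p t * cis (- F t)) has_derivative (\<lambda>h. 0)) (at t)" for t
  proof -
    have "(F has_derivative (\<lambda>h. h * w t)) (at t)"
      using F[of t] by (simp add: has_vector_derivative_def)
    then have "((\<lambda>t. cis (- F t)) has_derivative (\<lambda>h. (- (h * w t)) *\<^sub>R (\<i> * cis (- F t)))) (at t)"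
      by (intro has_derivative_cis has_derivative_minus)
    moreover have "(p has_derivative (\<lambda>h. h *\<^sub>R D t)) (at t)"
      using D[of t] by (simp add: has_vector_derivative_def)
    ultimately have "((\<lambda>t. p t * cis (- F t)) has_derivative
       (\<lambda>h. p t * ((- (h * w t)) *\<^sub>R (\<i> * cis (- F t))) + (h *\<^sub>R D t) * cis (- F t))) (at t)"
      by (intro has_derivative_mult)
    also have "(\<lambda>h. p t * ((- (h * w t)) *\<^sub>R (\<i> * cis (- F t))) + (h *\<^sub>R D t) * cis (- F t)) = (\<lambda>h. 0)"
      by (simp add: Dw scaleR_conv_of_real algebra_simps)
    finally show ?thesis .
  qed
  then have "p t * cis (- F t) = p 0 * cis (- F 0)" for t
    using has_derivative_zero_unique[of UNIV "\<lambda>t. p t * cis (- F t)" t 0] by simp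
  moreover have "cmod (p 0 * cis (- F 0)) = 1"
    by (simp add: norm_mult p1)
  then have "p 0 * cis (- F 0) = cis (Arg (p 0 * cis (- F 0)))"
    by (simp only: cis_Arg_unit)
  ultimately have q: "p t * cis (- F t) = cis (Arg (p 0 * cis (- F 0)))" for t
    by simp
  have "p t = p t * cis (- F t) * cis (F t)" for t
    by (simp add: mult.assoc cis_mult)
  then have eq: "p t = cis (Arg (p 0 * cis (- F 0)) + F t)" for t
    by (metis q cis_mult)
  show ?thesis
  proof
    show "(\<lambda>t. Arg (p 0 * cis (- F 0)) + F t) differentiable at t" for t
      using F by (intro derivative_intros differentiableI_vector)
    show "\<phi> (cis t) = cis (Arg (p 0 * cis (- F 0)) + F t)" for t
      using eq by (simp add: p_def)
  qed
qed

text \<open>Inverting twice with \<open>the_inv_into\<close> gives back \<open>\<phi>\<close> on the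
  circle, which suffices because \<open>C1_circle_map\<close> looks only at values there.\<close>

lemma C1_circle_diffeo_inv:
  assumes "C1_circle_diffeo \<phi>"
  shows "C1_circle_diffeo (the_inv_into unit_circle \<phi>)"
proof -
  let ?\<psi> = "the_inv_into unit_circle \<phi>"
  have bij: "bij_betw \<phi> unit_circle unit_circle"
    using assms by (simp add: C1_circle_diffeo_def)
  then have bij': "bij_betw ?\<psi> unit_circle unit_circle"
    by (rule bij_betw_the_inv_into)
  have "the_inv_into unit_circle ?\<psi> z = \<phi> z" if "z \<in> unit_circle" for z
    using bij bij' that
    by (metis bij_betw_def bij_betwE the_inv_into_f_f)
  then have "C1_circle_map (the_inv_into unit_circle ?\<psi>) \<longleftrightarrow> C1_circle_map \<phi>"
    by (simp add: C1_circle_map_def image_subset_iff)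
  then show ?thesis
    using assms bij' by (simp add: C1_circle_diffeo_def)
qed

text \<open>The lift \<open>\<eta>\<close> of the inverse undoes \<open>\<theta>\<close> up to
  multiples of 2 pi, so by the chain rule neither derivative can vanish. The nonzero
  \<open>\<theta>'\<close> is what later makes the logarithmic shift finite.\<close>

lemma C1_circle_diffeo_lift:
  assumes "C1_circle_diffeo \<phi>"
  obtains \<theta> \<theta>' :: "real \<Rightarrow> real"
  where "\<And>t. (\<theta> has_real_derivative \<theta>' t) (at t)" "\<And>t. \<theta>' t \<noteq> 0"
    "\<And>t. \<phi> (cis t) = cis (\<theta> t)"
proof -
  let ?\<psi> = "the_inv_into unit_circle \<phi>"
  have bij: "bij_betw \<phi> unit_circle unit_circle" and "C1_circle_map \<phi>" "C1_circle_map ?\<psi>"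
    using assms by (simp_all add: C1_circle_diffeo_def)
  then obtain \<theta> \<eta> :: "real \<Rightarrow> real"
    where \<theta>: "\<And>t. \<theta> differentiable at t" "\<And>t. \<phi> (cis t) = cis (\<theta> t)"
      and \<eta>: "\<And>t. \<eta> differentiable at t" "\<And>t. ?\<psi> (cis t) = cis (\<eta> t)"
    by (metis C1_circle_map_lift)
  have "\<forall>t. \<exists>d. (\<theta> has_real_derivative d) (at t)" "\<forall>t. \<exists>d. (\<eta> has_real_derivative d) (at t)"
    using \<theta>(1) \<eta>(1) by (simp_all add: real_differentiable_def)
  then obtain \<theta>' \<eta>' where \<theta>': "\<And>t. (\<theta> has_real_derivative \<theta>' t) (at t)"
    and \<eta>': "\<And>t. (\<eta> has_real_derivative \<eta>' t) (at t)"
    by metis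
  have "\<theta>' t \<noteq> 0" for t
  proof -
    have "cis (\<eta> (\<theta> t)) = cis t" for t
    proof -
      have "cis (\<eta> (\<theta> t)) = ?\<psi> (\<phi> (cis t))"
        using \<theta> \<eta> by simp
      also have "\<dots> = cis t"
        using bij by (intro the_inv_into_f_f) (auto simp: bij_betw_def)
      finally show ?thesis .
    qed
    \<comment> \<open>Comparing derivatives after applying \<open>cis\<close> avoids having to show
      that the multiple of 2 pi does not depend on \<open>t\<close>.\<close>
    then have eq: "(\<lambda>t. cis (\<eta> (\<theta> t))) = cis" by auto
    have "((\<lambda>t. \<eta> (\<theta> t)) has_real_derivative \<eta>' (\<theta> t) * \<theta>' t) (at t)"
      by (rule DERIV_chain2[OF \<eta>' \<theta>'])
    then have "((\<lambda>t. cis (\<eta> (\<theta> t))) has_derivative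
        (\<lambda>h. (\<eta>' (\<theta> t) * \<theta>' t * h) *\<^sub>R (\<i> * cis (\<eta> (\<theta> t))))) (at t)"
      unfolding has_field_derivative_def by (rule has_derivative_cis)
    moreover have "(cis has_derivative (\<lambda>h. h *\<^sub>R (\<i> * cis t))) (at t)"
      using has_derivative_cis[OF has_derivative_ident, of t UNIV] by simp
    ultimately have "(\<lambda>h. (\<eta>' (\<theta> t) * \<theta>' t * h) *\<^sub>R (\<i> * cis (\<eta> (\<theta> t)))) = (\<lambda>h. h *\<^sub>R (\<i> * cis t))"
      unfolding eq by (rule has_derivative_unique)
    from fun_cong[OF this, of 1] show ?thesis by auto
  qed
  with \<theta>' \<theta>(2) show ?thesis using that by blast
qed

lemma C1_circle_map_continuous_on:
  assumes "C1_circle_map \<phi>"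
  shows "continuous_on unit_circle \<phi>"
proof -
  obtain \<theta> :: "real \<Rightarrow> real" where \<theta>: "\<And>t. \<theta> differentiable at t" "\<And>t. \<phi> (cis t) = cis (\<theta> t)"
    using C1_circle_map_lift[OF assms] by blast
  have "continuous (at z within unit_circle) \<phi>" if z: "z \<in> unit_circle" for z
  proof -
    obtain a where a: "z = cis a"
      using z cis_Arg_unit by (metis mem_sphere_0)
    \<comment> \<open>The local inverse of \<open>cis\<close> is the branch of the angle centred at
      \<open>a\<close>. It jumps only at the point opposite to \<open>z\<close>, so it is continuous
      at \<open>z\<close>, while this formula for \<open>\<phi>\<close> is valid on the whole
      circle.\<close>
    have eq: "\<phi> u = cis (\<theta> (a + Arg (u * cis (- a))))" if u: "u \<in> unit_circle" for u
    proof -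
      have "cmod (u * cis (-a)) = 1" using u by (simp add: norm_mult)
      then have "cis (Arg (u * cis (-a))) = u * cis (-a)"
        by (simp only: cis_Arg_unit)
      then have "cis (a + Arg (u * cis (- a))) = cis a * (u * cis (- a))"
        by (metis cis_mult)
      also have "\<dots> = u" by (simp add: mult.left_commute cis_mult)
      finally show ?thesis using \<theta>(2) by metis
    qed
    have c: "isCont \<theta> t" for t
      using \<theta>(1) by (rule differentiable_imp_continuous_within)
    have 1: "isCont (\<lambda>u. Arg (u * cis (- a))) z"
      by (rule isCont_o2[OF _ continuous_at_Arg]) (auto simp: a cis_mult intro!: continuous_intros)
    have "isCont (\<lambda>u. \<theta> (a + Arg (u * cis (- a)))) z"
      by (rule isCont_o2[OF _ c]) (intro continuous_intros 1)
    moreover have "isCont cis t" for t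
      by (rule continuous_on_interior[of UNIV]) (auto intro!: continuous_intros)
    ultimately have "isCont (\<lambda>u. cis (\<theta> (a + Arg (u * cis (- a))))) z"
      by (rule isCont_o2)
    then have "continuous (at z within unit_circle) (\<lambda>u. cis (\<theta> (a + Arg (u * cis (- a)))))"
      by (rule continuous_at_imp_continuous_at_within)
    then show ?thesis
      by (rule continuous_transform_within[OF _ zero_less_one]) (use z eq in auto)
  qed
  then show ?thesis
    by (simp add: continuous_on_eq_continuous_within)
qed

section \<open>Null sets and measurability on the circle\<close>

lemma null_sets_circle_measure_iff:
  "N \<in> null_sets circle_measure \<longleftrightarrow> N \<in> sets circle_measure \<and> negligible (cis -` N)"
proof (cases "N \<in> sets circle_measure")
  case True
  let ?I = "{0..<2*pi}"
  let ?A = "cis -` N \<inter> ?I"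
  have cm: "cis \<in> restrict_space lborel ?I \<rightarrow>\<^sub>M restrict_space borel unit_circle"
    by (rule cis_measurable_circle)
  have "?A \<in> sets (restrict_space lborel ?I)"
    using measurable_sets[OF cm, of N] True
    by (simp add: sets_circle_measure space_restrict_space)
  then have A: "?A \<in> sets lborel"
    by (simp add: sets_restrict_space_iff)
  have "N \<in> null_sets circle_measure \<longleftrightarrow> ?A \<in> null_sets lborel"
    using True unfolding circle_measure_def
    by (subst null_sets_distr_iff[OF cm]) (auto simp: null_sets_restrict_space space_restrict_space)
  also have "\<dots> \<longleftrightarrow> negligible ?A"
    using A by (simp add: negligible_iff_null_sets null_sets_completion_iff)
  also have "\<dots> \<longleftrightarrow> negligible (cis -` N)"
  proof
    \<comment> \<open>By periodicity of \<open>cis\<close>, the full preimage is covered by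
      countably many translates of its part in one period.\<close>
    assume "negligible ?A"
    then have "negligible (\<Union>n::int. (+) (2 * pi * n) ` ?A)"
      by (intro negligible_countable_Union) (auto intro: negligible_translation)
    moreover have "cis -` N \<subseteq> (\<Union>n::int. (+) (2 * pi * n) ` ?A)"
    proof
      fix t assume t: "t \<in> cis -` N"
      define n where "n = \<lfloor>t / (2*pi)\<rfloor>"
      have "of_int n \<le> t / (2*pi)" "t / (2*pi) < of_int n + 1"
        by (auto simp: n_def)
      then have "t - 2 * pi * n \<in> ?I"
        by (auto simp: field_simps)
      moreover have "cis (t - 2 * pi * n) = cis t"
        by (simp add: cis_divide[symmetric] cis_multiple_2pi)
      ultimately have "t - 2 * pi * n \<in> ?A" using t by simp
      then show "t \<in> (\<Union>n::int. (+) (2 * pi * n) ` ?A)"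
        by (intro UN_I[of n] image_eqI[of _ _ "t - 2 * pi * n"]) auto
    qed
    ultimately show "negligible (cis -` N)"
      by (rule negligible_subset)
  qed (auto intro: negligible_subset)
  finally show ?thesis using True by simp
qed auto

lemma C1_circle_map_measurable:
  assumes "C1_circle_map \<phi>"
  shows "\<phi> \<in> circle_measure \<rightarrow>\<^sub>M circle_measure"
proof -
  have "\<phi> \<in> restrict_space borel unit_circle \<rightarrow>\<^sub>M restrict_space borel unit_circle"
  proof (rule measurable_restrict_space2)
    show "\<phi> \<in> borel_measurable (restrict_space borel unit_circle)"
      by (rule borel_measurable_continuous_on_restrict[OF C1_circle_map_continuous_on[OF assms]])
  qed (use assms in \<open>auto simp: C1_circle_map_def space_restrict_space\<close>)
  then show ?thesis
    by (simp cong: measurable_cong_sets add: sets_circle_measure)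
qed

text \<open>The preimage of a null set under \<open>\<phi>\<close> is its image under the inverse
  map, and the lift \<open>\<eta>\<close> of that inverse is differentiable, so it sends negligible
  sets to negligible sets. This is what makes the pullback well defined on classes.\<close>

lemma AE_circle_measure_compose:
  assumes "C1_circle_diffeo \<phi>" and "AE z in circle_measure. P z"
  shows "AE z in circle_measure. P (\<phi> z)"
proof -
  let ?\<psi> = "the_inv_into unit_circle \<phi>"
  have bij: "bij_betw \<phi> unit_circle unit_circle"
    and \<phi>: "C1_circle_map \<phi>" and \<psi>: "C1_circle_map ?\<psi>"
    using assms(1) by (simp_all add: C1_circle_diffeo_def)
  obtain N where N: "N \<in> null_sets circle_measure" "{z \<in> unit_circle. \<not> P z} \<subseteq> N"
    using assms(2) by (auto simp: eventually_ae_filter)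
  then have neg: "negligible (cis -` N)" and sets: "N \<in> sets circle_measure"
    by (simp_all add: null_sets_circle_measure_iff)
  obtain \<eta> :: "real \<Rightarrow> real" where \<eta>: "\<And>t. \<eta> differentiable at t" "\<And>t. ?\<psi> (cis t) = cis (\<eta> t)"
    using C1_circle_map_lift[OF \<psi>] by blast
  have "negligible (\<eta> ` (cis -` N))"
    by (rule negligible_differentiable_image_negligible[OF order_refl neg])
      (auto simp: differentiable_on_def intro: differentiable_at_withinI \<eta>(1))
  then have "negligible (\<Union>n::int. (+) (2 * pi * n) ` \<eta> ` (cis -` N))"
    by (intro negligible_countable_Union) (auto intro: negligible_translation)
  \<comment> \<open>Applying \<open>\<eta>\<close> to an angle of \<open>\<phi> (cis t)\<close>
    recovers \<open>t\<close> only modulo 2 pi; the integer translates account for the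
    difference.\<close>
  moreover have "cis -` (\<phi> -` N \<inter> unit_circle) \<subseteq> (\<Union>n::int. (+) (2 * pi * n) ` \<eta> ` (cis -` N))"
  proof
    fix t assume t: "t \<in> cis -` (\<phi> -` N \<inter> unit_circle)"
    have "\<phi> (cis t) \<in> unit_circle"
      using bij by (auto dest: bij_betwE)
    then obtain u where u: "\<phi> (cis t) = cis u"
      using cis_Arg_unit by (metis mem_sphere_0)
    have "cis t = ?\<psi> (\<phi> (cis t))"
      using bij by (intro the_inv_into_f_f[symmetric]) (auto simp: bij_betw_def)
    then have "cis t = cis (\<eta> u)" using u \<eta>(2) by simp
    then have "cis (t - \<eta> u) = 1"
      by (simp add: cis_divide[symmetric])
    then obtain n :: int where n: "t - \<eta> u = of_int n * (2*pi)"
      by (auto simp: cis_eq_1_iff)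
    have "u \<in> cis -` N" using t u by simp
    then show "t \<in> (\<Union>n::int. (+) (2 * pi * n) ` \<eta> ` (cis -` N))"
      using n by (intro UN_I[of n] image_eqI[of _ _ "\<eta> u"] imageI) (auto simp: algebra_simps)
  qed
  ultimately have "negligible (cis -` (\<phi> -` N \<inter> unit_circle))"
    by (rule negligible_subset)
  moreover have "\<phi> -` N \<inter> unit_circle \<in> sets circle_measure"
    using measurable_sets[OF C1_circle_map_measurable[OF \<phi>] sets] by simp
  ultimately have "\<phi> -` N \<inter> unit_circle \<in> null_sets circle_measure"
    by (simp add: null_sets_circle_measure_iff)
  moreover have "{z \<in> space circle_measure. \<not> P (\<phi> z)} \<subseteq> \<phi> -` N \<inter> unit_circle"
    using bij_betwE[OF bij] by (auto intro!: subsetD[OF N(2)])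
  ultimately show ?thesis
    by (rule AE_I')
qed

section \<open>Almost periodic functions on the line\<close>

lemma almost_periodic_uniformly_continuous:
  assumes "almost_periodic h"
  shows "uniformly_continuous_on UNIV h"
  unfolding uniformly_continuous_on_def
proof (intro allI impI)
  fix e :: real assume "0 < e"
  then obtain l where l: "0 < l" "\<And>t0. \<exists>\<tau>\<in>{t0..t0 + l}. \<forall>t. cmod (h t - h (t + \<tau>)) < e / 3"
    using assms unfolding almost_periodic_def by (meson divide_pos_pos zero_less_numeral)
  \<comment> \<open>An almost period \<open>\<tau>\<close> carries any close pair \<open>x\<close>,
    \<open>y\<close> into this fixed compact interval: \<open>x + \<tau>\<close> lands in
    \<open>{0..l}\<close>, and the margin 1 leaves room for \<open>y + \<tau>\<close>. Each of the
    two moves and the comparison inside the interval costs a third of \<open>e\<close>.\<close>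
  have "continuous_on {-1..l+1} h"
    using assms unfolding almost_periodic_def by (auto intro: continuous_on_subset)
  then have "uniformly_continuous_on {-1..l+1} h"
    by (rule compact_uniformly_continuous) simp
  then obtain d where d: "0 < d"
    "\<And>x y. x \<in> {-1..l+1} \<Longrightarrow> y \<in> {-1..l+1} \<Longrightarrow> dist y x < d \<Longrightarrow> dist (h y) (h x) < e / 3"
    by (rule uniformly_continuous_onE[where \<epsilon> = "e / 3"]) (use \<open>0 < e\<close> in simp, blast)
  have "dist (h y) (h x) < e" if xy: "dist y x < min d 1" for x y
  proof -
    obtain \<tau> where \<tau>: "\<tau> \<in> {-x..-x+l}" "\<And>t. cmod (h t - h (t + \<tau>)) < e / 3"
      using l(2) by blast
    have "dist (h (y + \<tau>)) (h (x + \<tau>)) < e / 3"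
      using xy \<tau>(1) by (intro d) (auto simp: dist_real_def)
    moreover have "dist (h y) (h (y + \<tau>)) < e / 3" "dist (h (x + \<tau>)) (h x) < e / 3"
      using \<tau>(2) by (simp_all add: dist_norm norm_minus_commute)
    moreover have "dist (h y) (h x)
        \<le> dist (h y) (h (y + \<tau>)) + dist (h (y + \<tau>)) (h (x + \<tau>)) + dist (h (x + \<tau>)) (h x)"
      by (smt (verit) dist_triangle)
    ultimately show ?thesis by linarith
  qed
  then show "\<exists>d>0. \<forall>x\<in>UNIV. \<forall>y\<in>UNIV. dist y x < d \<longrightarrow> dist (h y) (h x) < e"
    using \<open>0 < d\<close> by (intro exI[of _ "min d 1"]) auto
qed

lemma almost_periodic_translate:
  assumes "almost_periodic h"
  shows "almost_periodic (\<lambda>t. h (t + c))"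
  unfolding almost_periodic_def
proof (intro conjI allI impI)
  show "continuous_on UNIV (\<lambda>t. h (t + c))"
    using assms unfolding almost_periodic_def
    by (auto intro!: continuous_on_compose2[of UNIV h] continuous_intros)
  fix e :: real assume "0 < e"
  then obtain l where "0 < l" "\<And>t0. \<exists>\<tau>\<in>{t0..t0 + l}. \<forall>t. cmod (h t - h (t + \<tau>)) < e"
    using assms unfolding almost_periodic_def by blast
  moreover have "t + c + \<tau> = t + \<tau> + c" for t \<tau> by simp
  ultimately show "\<exists>l>0. \<forall>t0. \<exists>\<tau>\<in>{t0..t0 + l}. \<forall>t. cmod (h (t + c) - h (t + \<tau> + c)) < e"
    by metis
qed

section \<open>Arcs and the logarithmic angular coordinate\<close>

lemma Arg_arc:
  assumes "k \<in> {-1, 1}" "0 < r" "r < pi"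
  shows "Arg (cis (t0 + k * r) * cis (- t0)) = k * r" "cis (t0 + k * r) * cis (- t0) \<notin> \<real>\<^sub>\<le>\<^sub>0"
proof -
  have "cis (t0 + k * r) * cis (- t0) = cis (k * r)"
    by (simp add: cis_mult)
  moreover have "Arg (cis (k * r)) = k * r"
    using assms by (intro Arg_cis) auto
  moreover from this have "cis (k * r) \<notin> \<real>\<^sub>\<le>\<^sub>0"
    using assms Arg_eq_pi[of "cis (k * r)"] cis_neq_zero[of "k * r"]
    by (auto simp: complex_nonpos_Reals_iff complex_eq_iff order_le_less)
  ultimately show "Arg (cis (t0 + k * r) * cis (- t0)) = k * r" "cis (t0 + k * r) * cis (- t0) \<notin> \<real>\<^sub>\<le>\<^sub>0"
    by simp_all
qed

lemma circle_arc_subset_circle: "circle_arc t0 k s \<subseteq> unit_circle"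
  by (auto simp: circle_arc_def)

text \<open>Exhausting the open parameter interval by compact intervals presents the arc as a
  countable union of compact sets.\<close>

lemma sets_circle_arc: "circle_arc t0 k s \<in> sets circle_measure"
proof -
  let ?c = "\<lambda>t. cis (t0 + k * t)"
  have "circle_arc t0 k s = (\<Union>n::nat. ?c ` {inverse (Suc n)..s - inverse (Suc n)})"
  proof (intro equalityI subsetI)
    fix z assume "z \<in> circle_arc t0 k s"
    then obtain t where t: "z = ?c t" "0 < t" "t < s" by (auto simp: circle_arc_def)
    then obtain n :: nat where "inverse (Suc n) < min t (s - t)"
      using reals_Archimedean[of "min t (s - t)"] by auto
    then show "z \<in> (\<Union>n::nat. ?c ` {inverse (Suc n)..s - inverse (Suc n)})"
      using t(1) by (intro UN_I[of n] image_eqI[of _ _ t]) auto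
  next
    fix z assume "z \<in> (\<Union>n::nat. ?c ` {inverse (Suc n)..s - inverse (Suc n)})"
    then obtain n :: nat and t
      where t: "z = ?c t" "inverse (Suc n) \<le> t" "t \<le> s - inverse (Suc n)" by auto
    moreover have "0 < inverse (real (Suc n))" by simp
    ultimately have "0 < t" "t < s" by linarith+
    then show "z \<in> circle_arc t0 k s" using t(1) by (auto simp: circle_arc_def)
  qed
  moreover have "compact (?c ` {inverse (Suc n)..s - inverse (Suc n)})" for n :: nat
    by (intro compact_continuous_image continuous_intros) simp
  then have "(\<Union>n::nat. ?c ` {inverse (Suc n)..s - inverse (Suc n)}) \<in> sets borel"
    by (intro sets.countable_UN) (auto intro: borel_compact)
  ultimately show ?thesis
    using circle_arc_subset_circle[of t0 k s]
    by (simp add: sets_circle_measure sets_restrict_space_iff)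
qed

text \<open>This carries a function from the line to an arc: \<open>k * Arg (z * cis (- t0))\<close>
  is the angular distance of \<open>z\<close> from \<open>t0\<close>, and \<open>s < pi\<close>
  keeps the arc away from the cut of \<open>Arg\<close>.\<close>

lemma almost_periodic_on_arcI:
  assumes "almost_periodic h" "k \<in> {-1, 1}" "0 < s" "s < pi"
  shows "almost_periodic_on_arc t0 k s (\<lambda>z. h (ln (k * Arg (z * cis (- t0)))))"
  unfolding almost_periodic_on_arc_def
proof (intro conjI exI allI impI)
  have "continuous_on (circle_arc t0 k s) (\<lambda>z. Arg (z * cis (- t0)))"
  proof (rule continuous_at_imp_continuous_on, rule ballI)
    fix z assume "z \<in> circle_arc t0 k s"
    then have "z * cis (- t0) \<notin> \<real>\<^sub>\<le>\<^sub>0"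
      using Arg_arc(2)[OF assms(2)] assms(4) by (auto simp: circle_arc_def)
    then show "isCont (\<lambda>z. Arg (z * cis (- t0))) z"
      by (intro isCont_o2[OF _ continuous_at_Arg] continuous_intros)
  qed
  moreover have "0 < k * Arg (z * cis (- t0))" if "z \<in> circle_arc t0 k s" for z
  proof -
    obtain r where r: "z = cis (t0 + k * r)" "0 < r" "r < s"
      using \<open>z \<in> circle_arc t0 k s\<close> by (auto simp: circle_arc_def)
    have "Arg (z * cis (- t0)) = k * r"
      unfolding r(1) using r assms by (intro Arg_arc) auto
    then show ?thesis using r(2) assms(2) by auto
  qed
  ultimately have "continuous_on (circle_arc t0 k s) (\<lambda>z. ln (k * Arg (z * cis (- t0))))"
    by (intro continuous_on_ln continuous_on_mult_left) (metis less_irrefl)+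
  then show "continuous_on (circle_arc t0 k s) (\<lambda>z. h (ln (k * Arg (z * cis (- t0)))))"
    using assms(1) unfolding almost_periodic_def by (auto intro: continuous_on_compose2[of UNIV h])
  \<comment> \<open>\<open>almost_periodic_on_arc\<close> places the far end of the arc at
    \<open>t = 0\<close>. The distance there is \<open>s * exp t\<close>, whose logarithm is
    \<open>t + ln s\<close>, so a translate of \<open>h\<close> is the required witness.\<close>
  show "almost_periodic (\<lambda>t. h (t + ln s))"
    using assms(1) by (rule almost_periodic_translate)
  fix t :: real assume "t < 0"
  then have "s * exp t < pi" using assms
    by (smt (verit) exp_less_one_iff mult_less_cancel_left2)
  then have "Arg (cis (t0 + k * (s * exp t)) * cis (- t0)) = k * (s * exp t)"
    using assms by (intro Arg_arc) auto
  then have "k * Arg (cis (t0 + k * s * exp t) * cis (- t0)) = s * exp t"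
    using assms(2) by (auto simp: mult.assoc)
  then show "h (ln (k * Arg (cis (t0 + k * s * exp t) * cis (- t0)))) = h (t + ln s)"
    using assms(3) by (simp add: ln_mult add.commute)
qed

section \<open>Classes modulo null sets and membership in \<open>AP_circle\<close>\<close>

lemma linf_class_eqI: "linf_eq f g \<Longrightarrow> linf_class f = linf_class g"
  by (rule Quotient3_rel_abs[OF Quotient3_linf])

lemma linf_eq_refl: "linf_function f \<Longrightarrow> linf_eq f f"
  by (simp add: linf_eq_def)

lemma linf_class_rep: "linf_class (linf_rep F) = F"
  by (rule Quotient3_abs_rep[OF Quotient3_linf])

lemma linf_function_rep: "linf_function (linf_rep F)"
  using Quotient3_rep_reflp[OF Quotient3_linf, of F] by (simp add: linf_eq_def)

lemma linf_eq_rep_class: "linf_function f \<Longrightarrow> linf_eq (linf_rep (linf_class f)) f"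
  by (rule Quotient3_rep_abs[OF Quotient3_linf]) (rule linf_eq_refl)

lemma linf_class_eqD:
  "linf_function f \<Longrightarrow> linf_function g \<Longrightarrow> linf_class f = linf_class g \<Longrightarrow> linf_eq f g"
  using Quotient3_rel[OF Quotient3_linf, of f g] by (simp add: linf_eq_refl)

text \<open>A working form of the definition. The coordinate \<open>ln r\<close> no longer depends
  on the length \<open>s\<close> of the arc, the approximants live on the whole line, and the
  essential supremum becomes an almost everywhere bound for an arbitrary representative. The change
  of coordinate is a translation by \<open>ln s\<close>, which preserves almost periodicity.\<close>

lemma AP_circle_iff:
  assumes "linf_function f"
  shows "linf_class f \<in> AP_circle \<longleftrightarrow>
    (\<forall>t0. \<forall>\<epsilon>>0. \<exists>s. 0 < s \<and> s < pi \<and> (\<forall>k\<in>{-1, 1}. \<exists>h. almost_periodic h \<and>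
      (AE z in circle_measure. \<forall>r. 0 < r \<and> r < s \<and> z = cis (t0 + k * r) \<longrightarrow>
         cmod (f z - h (ln r)) \<le> \<epsilon>)))"
    (is "_ \<longleftrightarrow> ?R")
proof -
  let ?F = "linf_rep (linf_class f)"
  have AE_F: "AE z in circle_measure. ?F z = f z"
    using linf_eq_rep_class[OF assms] by (simp add: linf_eq_def)
  have AE_arc: "(AE z in restrict_space circle_measure (circle_arc t0 k s). P z) \<longleftrightarrow>
      (AE z in circle_measure. z \<in> circle_arc t0 k s \<longrightarrow> P z)" for t0 k s P
    using sets_circle_arc circle_arc_subset_circle
    by (intro AE_restrict_space_iff) (simp add: Int_absorb2)
  show ?thesis
  proof
    assume L: "linf_class f \<in> AP_circle"
    show ?R
    proof (intro allI impI)
      fix t0 \<epsilon> :: real assume "0 < \<epsilon>"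
      with L obtain s where s: "0 < s" "s < pi" and
        ex: "\<And>k. k \<in> {-1, 1} \<Longrightarrow> \<exists>g. almost_periodic_on_arc t0 k s g \<and>
          esssup (restrict_space circle_measure (circle_arc t0 k s))
            (\<lambda>z. ereal (cmod (?F z - g z))) < ereal \<epsilon>"
        unfolding AP_circle_def by blast
      have "\<exists>h. almost_periodic h \<and>
          (AE z in circle_measure. \<forall>r. 0 < r \<and> r < s \<and> z = cis (t0 + k * r) \<longrightarrow>
             cmod (f z - h (ln r)) \<le> \<epsilon>)" if k: "k \<in> {-1, 1}" for k
      proof -
        let ?M = "restrict_space circle_measure (circle_arc t0 k s)"
        obtain g where g: "almost_periodic_on_arc t0 k s g"
            "esssup ?M (\<lambda>z. ereal (cmod (?F z - g z))) < ereal \<epsilon>"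
          using ex[OF k] by blast
        then obtain h where h: "almost_periodic h" "\<And>t. t < 0 \<Longrightarrow> g (cis (t0 + k * s * exp t)) = h t"
          by (auto simp: almost_periodic_on_arc_def)
        have "AE z in ?M. ereal (cmod (?F z - g z)) \<le> esssup ?M (\<lambda>z. ereal (cmod (?F z - g z)))"
          by (rule esssup_AE)
        then have "AE z in ?M. cmod (?F z - g z) \<le> \<epsilon>"
        proof eventually_elim
          case (elim z)
          then have "ereal (cmod (?F z - g z)) < ereal \<epsilon>"
            using g(2) by (rule order.strict_trans1)
          then show ?case by simp
        qed
        then have "AE z in circle_measure. z \<in> circle_arc t0 k s \<longrightarrow> cmod (?F z - g z) \<le> \<epsilon>"
          by (simp only: AE_arc)
        \<comment> \<open>The shift by \<open>- ln s\<close> undoes the normalisation of the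
          coordinate in \<open>almost_periodic_on_arc\<close>.\<close>
        then have "AE z in circle_measure. \<forall>r. 0 < r \<and> r < s \<and> z = cis (t0 + k * r) \<longrightarrow>
             cmod (f z - h (ln r + (- ln s))) \<le> \<epsilon>"
          using AE_F
        proof eventually_elim
          case (elim z)
          show ?case
          proof (intro allI impI)
            fix r assume r: "0 < r \<and> r < s \<and> z = cis (t0 + k * r)"
            then have "g (cis (t0 + k * s * exp (ln (r / s)))) = h (ln (r / s))"
              using s by (intro h(2)) auto
            moreover have "k * s * exp (ln (r / s)) = k * r"
              using r s by simp
            ultimately have "g z = h (ln (r / s))"
              using r by (simp only:)
            then have "g z = h (ln r + (- ln s))"
              using r s by (simp add: ln_div)
            moreover have "z \<in> circle_arc t0 k s" using r by (auto simp: circle_arc_def)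
            ultimately show "cmod (f z - h (ln r + (- ln s))) \<le> \<epsilon>"
              using elim by simp
          qed
        qed
        then show ?thesis
          using almost_periodic_translate[OF h(1)] by blast
      qed
      then show "\<exists>s. 0 < s \<and> s < pi \<and> (\<forall>k\<in>{-1, 1}. \<exists>h. almost_periodic h \<and>
        (AE z in circle_measure. \<forall>r. 0 < r \<and> r < s \<and> z = cis (t0 + k * r) \<longrightarrow>
         cmod (f z - h (ln r)) \<le> \<epsilon>))"
        using s by blast
    qed
  next
    assume R: ?R
    show "linf_class f \<in> AP_circle"
      unfolding AP_circle_def
    proof (intro CollectI allI impI)
      fix t0 \<epsilon> :: real assume "0 < \<epsilon>"
      \<comment> \<open>Halving turns the non-strict almost everywhere bound into the strict bound
        on the essential supremum.\<close>
      then have "0 < \<epsilon> / 2" by simp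
      with R obtain s where s: "0 < s" "s < pi" and
        ex: "\<And>k. k \<in> {-1, 1} \<Longrightarrow> \<exists>h. almost_periodic h \<and>
          (AE z in circle_measure. \<forall>r. 0 < r \<and> r < s \<and> z = cis (t0 + k * r) \<longrightarrow>
             cmod (f z - h (ln r)) \<le> \<epsilon> / 2)"
        by blast
      have "\<exists>g. almost_periodic_on_arc t0 k s g \<and>
          esssup (restrict_space circle_measure (circle_arc t0 k s))
            (\<lambda>z. ereal (cmod (?F z - g z))) < ereal \<epsilon>" if k: "k \<in> {-1, 1}" for k
      proof -
        let ?M = "restrict_space circle_measure (circle_arc t0 k s)"
        obtain h where h: "almost_periodic h" and
          AE_h: "AE z in circle_measure. \<forall>r. 0 < r \<and> r < s \<and> z = cis (t0 + k * r) \<longrightarrow>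
             cmod (f z - h (ln r)) \<le> \<epsilon> / 2"
          using ex[OF k] by blast
        define g where "g z = h (ln (k * Arg (z * cis (- t0))))" for z
        have g: "almost_periodic_on_arc t0 k s g"
          unfolding g_def by (rule almost_periodic_on_arcI[OF h k s])
        have "AE z in circle_measure. z \<in> circle_arc t0 k s \<longrightarrow> ereal (cmod (?F z - g z)) \<le> ereal (\<epsilon> / 2)"
          using AE_h AE_F
        proof eventually_elim
          case (elim z)
          show ?case
          proof
            assume "z \<in> circle_arc t0 k s"
            then obtain r where r: "z = cis (t0 + k * r)" "0 < r" "r < s"
              by (auto simp: circle_arc_def)
            have "Arg (z * cis (- t0)) = k * r"
              unfolding r(1) using r s k by (intro Arg_arc) auto
            then have "g z = h (ln r)" using k by (auto simp: g_def)
            then show "ereal (cmod (?F z - g z)) \<le> ereal (\<epsilon> / 2)"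
              using elim r by simp
          qed
        qed
        then have "AE z in ?M. ereal (cmod (?F z - g z)) \<le> ereal (\<epsilon> / 2)"
          by (simp only: AE_arc)
        \<comment> \<open>Continuity of \<open>g\<close> is known only on the arc, so measurability
          is derived relative to the arc, whose sigma-algebra is the trace of the Borel
          sets.\<close>
        moreover have [measurable]: "g \<in> borel_measurable ?M"
        proof -
          have "g \<in> borel_measurable (restrict_space borel (circle_arc t0 k s))"
            using g by (intro borel_measurable_continuous_on_restrict) (simp add: almost_periodic_on_arc_def)
          also have "borel_measurable (restrict_space borel (circle_arc t0 k s)) = borel_measurable ?M"
          proof (intro measurable_cong_sets refl)
            have "sets ?M = sets (restrict_space (restrict_space borel unit_circle) (circle_arc t0 k s))"
              by (intro sets_restrict_space_cong sets_circle_measure)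
            then show "sets (restrict_space borel (circle_arc t0 k s)) = sets ?M"
              using circle_arc_subset_circle[of t0 k s]
              by (simp add: sets_restrict_restrict_space Int_absorb1)
          qed
          finally show ?thesis .
        qed
        have [measurable]: "?F \<in> borel_measurable ?M"
          using linf_function_rep by (intro measurable_restrict_space1) (simp add: linf_function_def)
        ultimately have "esssup ?M (\<lambda>z. ereal (cmod (?F z - g z))) \<le> ereal (\<epsilon> / 2)"
          by (intro esssup_I) measurable
        also have "\<dots> < ereal \<epsilon>" using \<open>0 < \<epsilon>\<close> by simp
        finally show ?thesis using g by blast
      qed
      then show "\<exists>s. 0 < s \<and> s < pi \<and> (\<forall>k\<in>{-1, 1}. \<exists>g. almost_periodic_on_arc t0 k s g \<and>
        esssup (restrict_space circle_measure (circle_arc t0 k s))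
          (\<lambda>z. ereal (cmod (?F z - g z))) < ereal \<epsilon>)"
        using s by blast
    qed
  qed
qed

section \<open>Pullback along a diffeomorphism\<close>

lemma linf_function_compose:
  assumes "C1_circle_diffeo \<phi>" "linf_function f"
  shows "linf_function (f \<circ> \<phi>)"
proof (rule linf_functionI)
  have "\<phi> \<in> circle_measure \<rightarrow>\<^sub>M circle_measure"
    using assms(1) by (simp add: C1_circle_diffeo_def C1_circle_map_measurable)
  then show "f \<circ> \<phi> \<in> borel_measurable circle_measure"
    using linf_function_measurable[OF assms(2)] by (rule measurable_comp)
  show "AE z in circle_measure. cmod ((f \<circ> \<phi>) z) \<le> real_of_ereal (ess_norm f)"
    using AE_circle_measure_compose[OF assms(1) AE_le_ess_norm[OF assms(2)]] by simp
qed

lemma linf_eq_compose: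
  assumes "C1_circle_diffeo \<phi>" "linf_eq f g"
  shows "linf_eq (f \<circ> \<phi>) (g \<circ> \<phi>)"
  using assms AE_circle_measure_compose[OF assms(1), of "\<lambda>z. f z = g z"]
  by (simp add: linf_eq_def linf_function_compose)

text \<open>Because null sets are preserved, the representative picked by \<open>linf_rep\<close>
  may be replaced by any other.\<close>

lemma linf_pullback_class:
  assumes "C1_circle_diffeo \<phi>" "linf_function f"
  shows "linf_pullback \<phi> (linf_class f) = linf_class (f \<circ> \<phi>)"
  unfolding linf_pullback_def
  by (intro linf_class_eqI linf_eq_compose linf_eq_rep_class assms)

text \<open>Half of \<open>\<epsilon>\<close> pays for approximating \<open>f\<close> near
  \<open>\<theta> t0\<close>, the other half for replacing the logarithmic distance of the image
  point by its limiting value \<open>ln r + ln c\<close>.\<close>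

lemma AP_circle_compose:
  assumes \<phi>: "C1_circle_diffeo \<phi>" and f: "linf_function f" and AP: "linf_class f \<in> AP_circle"
  shows "linf_class (f \<circ> \<phi>) \<in> AP_circle"
  unfolding AP_circle_iff[OF linf_function_compose[OF \<phi> f]]
proof (intro allI impI)
  fix t0 \<epsilon> :: real assume "0 < \<epsilon>"
  obtain \<theta> \<theta>' where \<theta>: "\<And>t. (\<theta> has_real_derivative \<theta>' t) (at t)" "\<And>t. \<theta>' t \<noteq> 0"
      "\<And>t. \<phi> (cis t) = cis (\<theta> t)"
    using C1_circle_diffeo_lift[OF \<phi>] by blast
  \<comment> \<open>\<open>c\<close> is the stretching factor at \<open>t0\<close> and
    \<open>\<sigma>\<close> the orientation: the side \<open>k\<close> of \<open>t0\<close> is sent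
    to the side \<open>\<sigma> * k\<close> of \<open>\<theta> t0\<close>.\<close>
  define c \<sigma> where "c = \<bar>\<theta>' t0\<bar>" and "\<sigma> = sgn (\<theta>' t0)"
  have c: "0 < c" "\<sigma> * \<theta>' t0 = c" and \<sigma>: "\<sigma> \<in> {-1, 1}"
    using \<theta>(2)[of t0] by (auto simp: c_def \<sigma>_def sgn_if)
  have "0 < \<epsilon> / 2" using \<open>0 < \<epsilon>\<close> by simp
  then obtain s' where s': "0 < s'" and ex: "\<forall>k\<in>{-1, 1}. \<exists>h. almost_periodic h \<and>
      (AE z in circle_measure. \<forall>r. 0 < r \<and> r < s' \<and> z = cis (\<theta> t0 + k * r) \<longrightarrow>
         cmod (f z - h (ln r)) \<le> \<epsilon> / 2)"
    using AP unfolding AP_circle_iff[OF f] by blast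
  from bchoice[OF ex] obtain H where "\<forall>k\<in>{-1, 1}. almost_periodic (H k) \<and>
      (AE z in circle_measure. \<forall>r. 0 < r \<and> r < s' \<and> z = cis (\<theta> t0 + k * r) \<longrightarrow>
         cmod (f z - H k (ln r)) \<le> \<epsilon> / 2)" ..
  then have H: "almost_periodic (H k)" and
    AE_H: "AE z in circle_measure. \<forall>r. 0 < r \<and> r < s' \<and> z = cis (\<theta> t0 + k * r) \<longrightarrow>
         cmod (f z - H k (ln r)) \<le> \<epsilon> / 2" if "k \<in> {-1, 1}" for k
    using that by auto
  have "\<exists>d>0. \<forall>x y. dist x y < d \<longrightarrow> dist (H k x) (H k y) < \<epsilon> / 2" if "k \<in> {-1, 1}" for k
    using almost_periodic_uniformly_continuous[OF H[OF that]] \<open>0 < \<epsilon> / 2\<close>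
    unfolding uniformly_continuous_on_def by (meson UNIV_I)
  then obtain d1 d2 where d12: "0 < d1" "\<And>x y. dist x y < d1 \<Longrightarrow> dist (H (-1) x) (H (-1) y) < \<epsilon> / 2"
      "0 < d2" "\<And>x y. dist x y < d2 \<Longrightarrow> dist (H 1 x) (H 1 y) < \<epsilon> / 2"
    by (metis insertCI)
  define d where "d = min d1 d2"
  have d: "0 < d" "\<And>k x y. k \<in> {-1, 1} \<Longrightarrow> dist x y < d \<Longrightarrow> dist (H k x) (H k y) < \<epsilon> / 2"
    using d12 by (auto simp: d_def)
  define q where "q x = (\<theta> (t0 + x) - \<theta> t0) / x" for x
  have "(q \<longlongrightarrow> \<theta>' t0) (at 0)"
    using \<theta>(1)[of t0] unfolding DERIV_def q_def .
  then have lim: "((\<lambda>x. \<sigma> * q x) \<longlongrightarrow> c) (at 0)"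
    using c(2) tendsto_mult_left by metis
  \<comment> \<open>This logarithm is exactly the deviation from the translation by
    \<open>ln c\<close>. Only a punctured neighbourhood matters, so the value of \<open>q\<close> at
    0 is irrelevant.\<close>
  then have "((\<lambda>x. ln (\<sigma> * q x / c)) \<longlongrightarrow> ln (c / c)) (at 0)"
    using c(1) by (intro tendsto_intros) auto
  then have "((\<lambda>x. ln (\<sigma> * q x / c)) \<longlongrightarrow> 0) (at 0)"
    using c(1) by simp
  from tendstoD[OF this d(1)] have "\<forall>\<^sub>F x in at 0. \<bar>ln (\<sigma> * q x / c)\<bar> < d"
    by (simp add: dist_real_def)
  moreover have "\<forall>\<^sub>F x in at 0. 0 < \<sigma> * q x"
    using order_tendstoD(1)[OF lim c(1)] .
  moreover have "\<forall>\<^sub>F x in at 0. \<bar>\<theta> (t0 + x) - \<theta> t0\<bar> < s'"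
  proof -
    have "isCont \<theta> t0" using \<theta>(1) by (rule DERIV_isCont)
    then have "((\<lambda>x. \<theta> (t0 + x)) \<longlongrightarrow> \<theta> t0) (at 0)"
      by (simp add: isCont_iff)
    from tendstoD[OF this s'] show ?thesis by (simp add: dist_real_def)
  qed
  ultimately have "\<forall>\<^sub>F x in at 0. \<bar>ln (\<sigma> * q x / c)\<bar> < d \<and> 0 < \<sigma> * q x \<and> \<bar>\<theta> (t0 + x) - \<theta> t0\<bar> < s'"
    by eventually_elim simp
  then obtain s0 where s0: "0 < s0" "\<And>x. x \<noteq> 0 \<Longrightarrow> \<bar>x\<bar> < s0 \<Longrightarrow>
      \<bar>ln (\<sigma> * q x / c)\<bar> < d \<and> 0 < \<sigma> * q x \<and> \<bar>\<theta> (t0 + x) - \<theta> t0\<bar> < s'"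
    unfolding eventually_at by (auto simp: dist_real_def)
  define s where "s = min s0 (pi / 2)"
  have s: "0 < s" "s < pi" "s \<le> s0"
    using s0(1) pi_gt_zero by (auto simp: s_def min_def)
  have "\<exists>h. almost_periodic h \<and>
      (AE z in circle_measure. \<forall>r. 0 < r \<and> r < s \<and> z = cis (t0 + k * r) \<longrightarrow>
         cmod ((f \<circ> \<phi>) z - h (ln r)) \<le> \<epsilon>)" if k: "k \<in> {-1, 1}" for k
  proof (intro exI conjI)
    have \<sigma>k: "\<sigma> * k \<in> {-1, 1}" using \<sigma> k by auto
    show "almost_periodic (\<lambda>t. H (\<sigma> * k) (t + ln c))"
      by (rule almost_periodic_translate[OF H[OF \<sigma>k]])
    show "AE z in circle_measure. \<forall>r. 0 < r \<and> r < s \<and> z = cis (t0 + k * r) \<longrightarrow>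
         cmod ((f \<circ> \<phi>) z - H (\<sigma> * k) (ln r + ln c)) \<le> \<epsilon>"
      using AE_circle_measure_compose[OF \<phi> AE_H[OF \<sigma>k]]
    proof eventually_elim
      case (elim z)
      show ?case
      proof (intro allI impI)
        fix r assume r: "0 < r \<and> r < s \<and> z = cis (t0 + k * r)"
        let ?q = "\<sigma> * q (k * r)"
        \<comment> \<open>\<open>\<rho>\<close> is the angular distance of the image point from
          \<open>\<theta> t0\<close>, measured on the side \<open>\<sigma> * k\<close>. Since
          \<open>k * k = 1\<close>, it equals \<open>r\<close> times the oriented difference
          quotient.\<close>
        define \<rho> where "\<rho> = \<sigma> * k * (\<theta> (t0 + k * r) - \<theta> t0)"
        have "k * r \<noteq> 0" "\<bar>k * r\<bar> < s0"
          using r k s by (auto simp: abs_mult)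
        then have *: "\<bar>ln (?q / c)\<bar> < d" "0 < ?q" "\<bar>\<theta> (t0 + k * r) - \<theta> t0\<bar> < s'"
          using s0(2) by blast+
        have \<rho>_eq: "\<rho> = ?q * r"
          using k r by (auto simp: \<rho>_def q_def)
        then have "0 < \<rho>" using *(2) r by simp
        moreover have "\<rho> < s'"
          using *(3) \<sigma>k unfolding \<rho>_def by auto
        moreover have "\<phi> z = cis (\<theta> t0 + \<sigma> * k * \<rho>)"
          using r \<theta>(3) \<sigma>k by (auto simp: \<rho>_def)
        ultimately have 1: "cmod (f (\<phi> z) - H (\<sigma> * k) (ln \<rho>)) \<le> \<epsilon> / 2"
          using elim by blast
        have "ln \<rho> = ln ?q + ln r"
          using *(2) r by (simp only: \<rho>_eq ln_mult_pos)
        moreover have "ln (?q / c) = ln ?q - ln c"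
          by (rule ln_divide_pos[OF *(2) c(1)])
        ultimately have "ln \<rho> - (ln r + ln c) = ln (?q / c)"
          by simp
        then have "dist (ln \<rho>) (ln r + ln c) < d"
          using *(1) by (simp only: dist_real_def)
        then have 2: "cmod (H (\<sigma> * k) (ln \<rho>) - H (\<sigma> * k) (ln r + ln c)) < \<epsilon> / 2"
          using d(2)[OF \<sigma>k] by (simp only: dist_norm)
        show "cmod ((f \<circ> \<phi>) z - H (\<sigma> * k) (ln r + ln c)) \<le> \<epsilon>"
          using norm_triangle_ineq[of "f (\<phi> z) - H (\<sigma> * k) (ln \<rho>)"
              "H (\<sigma> * k) (ln \<rho>) - H (\<sigma> * k) (ln r + ln c)"] 1 2 by simp
      qed
    qed
  qed
  then show "\<exists>s. 0 < s \<and> s < pi \<and> (\<forall>k\<in>{-1, 1}. \<exists>h. almost_periodic h \<and>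
      (AE z in circle_measure. \<forall>r. 0 < r \<and> r < s \<and> z = cis (t0 + k * r) \<longrightarrow>
         cmod ((f \<circ> \<phi>) z - h (ln r)) \<le> \<epsilon>))"
    using s by blast
qed

lemma AP_compose:
  assumes \<phi>: "C1_circle_diffeo \<phi>" and S: "S \<subseteq> unit_circle"
    and f: "linf_function f" and AP: "linf_class f \<in> AP (\<phi> ` S)"
  shows "linf_class (f \<circ> \<phi>) \<in> AP S"
proof -
  obtain g where g: "linf_function g" "linf_class g = linf_class f"
      "continuous_on (unit_circle - \<phi> ` S) g"
    using AP by (auto simp: AP_def)
  have bij: "bij_betw \<phi> unit_circle unit_circle" and "C1_circle_map \<phi>"
    using \<phi> by (simp_all add: C1_circle_diffeo_def)
  then have "continuous_on (unit_circle - S) \<phi>"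
    by (meson C1_circle_map_continuous_on continuous_on_subset Diff_subset)
  moreover have "\<phi> ` (unit_circle - S) \<subseteq> unit_circle - \<phi> ` S"
    using bij inj_on_image_set_diff[of \<phi> unit_circle unit_circle S] S
    by (simp add: bij_betw_def del: image_subset_iff)
  ultimately have "continuous_on (unit_circle - S) (g \<circ> \<phi>)"
    using g(3) by (metis continuous_on_compose continuous_on_subset)
  moreover have "linf_class (g \<circ> \<phi>) = linf_class (f \<circ> \<phi>)"
    using linf_class_eqD[OF g(1) f g(2)] by (intro linf_class_eqI linf_eq_compose \<phi>)
  ultimately show ?thesis
    using AP AP_circle_compose[OF \<phi> f] linf_function_compose[OF \<phi> g(1)]
    by (auto simp: AP_def)
qed

section \<open>The isomorphism of algebras\<close>

lemma linf_class_cases: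
  obtains f where "linf_function f" "F = linf_class f"
  using linf_function_rep linf_class_rep by metis

lemma linf_pullback_AP:
  assumes "C1_circle_diffeo \<phi>" "S \<subseteq> unit_circle" "F \<in> AP (\<phi> ` S)"
  shows "linf_pullback \<phi> F \<in> AP S"
  by (rule linf_class_cases[of F]) (use assms AP_compose in \<open>auto simp: linf_pullback_class\<close>)

text \<open>Pullback reverses composition, so a one-sided identity suffices here; exchanging the two
  maps gives the other side.\<close>

lemma linf_pullback_inverse:
  assumes \<phi>: "C1_circle_diffeo \<phi>" and \<psi>: "C1_circle_diffeo \<psi>"
    and inv: "\<And>z. z \<in> unit_circle \<Longrightarrow> \<phi> (\<psi> z) = z"
  shows "linf_pullback \<psi> (linf_pullback \<phi> F) = F"
proof (rule linf_class_cases[of F])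
  fix f assume f: "linf_function f" "F = linf_class f"
  have "AE z in circle_measure. (f \<circ> \<phi> \<circ> \<psi>) z = f z"
    by (rule AE_I2) (simp add: inv)
  then have "linf_eq (f \<circ> \<phi> \<circ> \<psi>) f"
    unfolding linf_eq_def using f(1) by (intro conjI linf_function_compose \<phi> \<psi>)
  then show ?thesis
    using f by (simp add: linf_pullback_class linf_function_compose \<phi> \<psi> linf_class_eqI)
qed

lemma norm_linf_class: "linf_function f \<Longrightarrow> norm (linf_class f) = real_of_ereal (ess_norm f)"
  by (simp add: norm_linf.abs_eq linf_eq_refl)

text \<open>An almost everywhere bound for \<open>f\<close> is also one for
  \<open>f \<circ> \<phi>\<close>. Applying this to the inverse diffeomorphism as well yields
  equality of norms.\<close>

lemma norm_linf_pullback_le: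
  assumes "C1_circle_diffeo \<phi>"
  shows "norm (linf_pullback \<phi> F) \<le> norm F"
proof (rule linf_class_cases[of F])
  fix f assume f: "linf_function f" "F = linf_class f"
  have "real_of_ereal (ess_norm (f \<circ> \<phi>)) \<le> real_of_ereal (ess_norm f)"
    using AE_circle_measure_compose[OF assms AE_le_ess_norm[OF f(1)]]
    by (simp add: real_ess_norm_le_iff linf_function_compose assms f(1))
  then show ?thesis
    using f by (simp add: linf_pullback_class norm_linf_class linf_function_compose assms)
qed

text \<open>The first conjunct certifies that \<open>linf_pullback\<close>, which is defined through
  a chosen representative, is composition with \<open>\<phi>\<close> for every
  representative.\<close>

theorem corollary1p5:
  fixes S :: "complex set" and \<phi> :: "complex \<Rightarrow> complex"
  assumes "S \<subseteq> unit_circle" and "closed S" and "S \<noteq> {}"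
    and "C1_circle_diffeo \<phi>"
  shows "(\<forall>f. linf_function f \<and> linf_class f \<in> AP (\<phi> ` S) \<longrightarrow>
            linf_function (f \<circ> \<phi>) \<and> linf_pullback \<phi> (linf_class f) = linf_class (f \<circ> \<phi>))
       \<and> uniform_algebra_iso (AP (\<phi> ` S)) (AP S) (linf_pullback \<phi>)"
proof -
  define \<psi> where "\<psi> = the_inv_into unit_circle \<phi>"
  note \<phi> = assms(4)
  have \<psi>: "C1_circle_diffeo \<psi>"
    unfolding \<psi>_def by (rule C1_circle_diffeo_inv[OF \<phi>])
  have bij: "bij_betw \<phi> unit_circle unit_circle"
    using \<phi> by (simp add: C1_circle_diffeo_def)
  have \<phi>\<psi>: "\<phi> (\<psi> z) = z" if "z \<in> unit_circle" for z
    unfolding \<psi>_def using bij that by (intro f_the_inv_into_f_bij_betw) auto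
  have \<psi>\<phi>: "\<psi> (\<phi> z) = z" if "z \<in> unit_circle" for z
    unfolding \<psi>_def using bij that by (intro the_inv_into_f_f) (auto simp: bij_betw_def)
  have S: "\<psi> ` \<phi> ` S = S" "\<phi> ` S \<subseteq> unit_circle"
    using \<psi>\<phi> assms(1) bij by (force simp: bij_betw_def)+
  have inv\<phi>: "linf_pullback \<psi> (linf_pullback \<phi> F) = F" for F
    using \<phi> \<psi> \<phi>\<psi> by (rule linf_pullback_inverse)
  have inv\<psi>: "linf_pullback \<phi> (linf_pullback \<psi> F) = F" for F
    using \<psi> \<phi> \<psi>\<phi> by (rule linf_pullback_inverse)
  have bij_pb: "bij_betw (linf_pullback \<phi>) (AP (\<phi> ` S)) (AP S)"
  proof (rule bij_betw_byWitness[where f' = "linf_pullback \<psi>"])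
    show "\<forall>F\<in>AP (\<phi> ` S). linf_pullback \<psi> (linf_pullback \<phi> F) = F"
      by (simp add: inv\<phi>)
    show "\<forall>F\<in>AP S. linf_pullback \<phi> (linf_pullback \<psi> F) = F"
      by (simp add: inv\<psi>)
    show "linf_pullback \<phi> ` AP (\<phi> ` S) \<subseteq> AP S"
      using linf_pullback_AP[OF \<phi> assms(1)] by blast
    show "linf_pullback \<psi> ` AP S \<subseteq> AP (\<phi> ` S)"
      using linf_pullback_AP[OF \<psi> S(2)] unfolding S(1) by blast
  qed
  have norm_pb: "norm (linf_pullback \<phi> F) = norm F" for F
    using norm_linf_pullback_le[OF \<phi>, of F] norm_linf_pullback_le[OF \<psi>, of "linf_pullback \<phi> F"]
    by (simp add: inv\<phi>)
  note pb = linf_pullback_class[OF \<phi>] and comp = linf_function_compose[OF \<phi>]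
  have one: "linf_pullback \<phi> 1 = 1"
    by (simp add: one_linf.abs_eq pb linf_function_const comp_def)
  have add: "linf_pullback \<phi> (F + G) = linf_pullback \<phi> F + linf_pullback \<phi> G" for F G
    by (rule linf_class_cases[of F], rule linf_class_cases[of G])
      (use comp in \<open>simp add: plus_linf.abs_eq pb linf_eq_refl linf_function_add comp_def\<close>)
  have mult: "linf_pullback \<phi> (F * G) = linf_pullback \<phi> F * linf_pullback \<phi> G" for F G
    by (rule linf_class_cases[of F], rule linf_class_cases[of G])
      (use comp in \<open>simp add: times_linf.abs_eq pb linf_eq_refl linf_function_mult comp_def\<close>)
  have scale: "linf_pullback \<phi> (cscale a F) = cscale a (linf_pullback \<phi> F)" for a F
    by (rule linf_class_cases[of F])
      (use comp in \<open>simp add: cscale.abs_eq pb linf_eq_refl linf_function_mult linf_function_const comp_def\<close>)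
  show ?thesis
    using bij_pb norm_pb one add mult scale pb comp by (simp add: uniform_algebra_iso_def)
qed

end
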